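(* Let $q$ be a power of an odd prime, and write $q = 4k+1$ or $q = 4k+3$ for some integer $k$. For any two distinct elements $a,b \in \mathbb{F}_q$, we have $$L_q(a,b) = k + \begin{cases} (\chi(a-b)-1)/2, & \text{if } q \equiv 1 \pmod 4,\\ 0, & \text{if } q \equiv 3 \pmod 4.\end{cases}$$
   Context: $\mathbb{F}_q$ is the finite field of $q$ elements. For polynomials $f_1,\ldots,f_n \in \mathbb{F}_q[X]$, $\mathcal{G}(f_1,\ldots,f_n)$ is the directed graph with nodes labelled by the elements of $\mathbb{F}_q$ and with an edge from $u$ to $v$ ($u,v\in\mathbb{F}_q$) if and only if $f_i(u)=v$ for some $i=1,\ldots,n$. A leaf is a vertex of in-degree $0$. For pairwise distinct $a_1,\ldots,a_n\in\mathbb{F}_q$, $L_q(a_1,\ldots,a_n)$ denotes the number of leaves in $\mathcal{G}(X^2+a_1,\ldots,X^2+a_n)$. $\chi$ is the quadratic character of $\mathbb{F}_q$: $\chi(u)=1$ if $u$ is a non-zero square in $\mathbb{F}_q$, $\chi(0)=0$, and $\chi(u)=-1$ if $u$ is not a square in $\mathbb{F}_q$. *)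

theory Defs
  imports
    Complex_Main
    "HOL-Computational_Algebra.Polynomial"
    "HOL-Computational_Algebra.Primes"
    "Graph_Theory.Pair_Digraph"
begin

text \<open>
  A finite field of \<open>q\<close> elements is a type of classes \<open>field\<close> and \<open>finite\<close> with
  \<open>card (UNIV :: 'a set) = q\<close>. The polynomials are collected in a list; since the arcs of a
  \<open>pair_pre_digraph\<close> form a set of pairs, several polynomials sending \<open>u\<close> to \<open>v\<close> give
  one edge only.
\<close>

definition poly_graph :: "'a::{field,finite} poly list \<Rightarrow> 'a pair_pre_digraph" where
  "poly_graph fs = \<lparr> pverts = UNIV, parcs = {(u, v). \<exists>f \<in> set fs. poly f u = v} \<rparr>"

definition leaves :: "'a pair_pre_digraph \<Rightarrow> 'a set" where
  "leaves G = {v \<in> pverts G. in_degree (with_proj G) v = 0}"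

definition num_leaves :: "'a::{field,finite} list \<Rightarrow> nat" where
  "num_leaves as = card (leaves (poly_graph (map (\<lambda>a. [:a, 0, 1:]) as)))"

definition quadratic_character :: "'a::{field,finite} \<Rightarrow> int" where
  "quadratic_character u =
     (if u = 0 then 0 else if \<exists>w. u = w\<^sup>2 then 1 else - 1)"

end

theory Submission
  imports Defs
begin

text \<open>
  A vertex \<open>v\<close> is a leaf exactly when neither \<open>v - a\<close> nor \<open>v - b\<close> is a square. Hence the product
  \<open>(1 - \<chi>(v - a)) (1 - \<chi>(v - b))\<close> is \<open>4\<close> at a leaf, and it vanishes at every other vertex except
  possibly at \<open>v = a\<close> and \<open>v = b\<close>, where one factor is \<open>1\<close>. The sum of the products over all \<open>v\<close>
  is \<open>q - 1\<close>: it expands into \<open>q\<close>, two sums of \<open>\<chi>\<close> over the field, which vanish, and the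
  correlation sum of \<open>\<chi>(v - a) \<chi>(v - b)\<close>, which is \<open>-1\<close> because the hyperbola
  \<open>x\<^sup>2 + a = y\<^sup>2 + b\<close> has \<open>q - 1\<close> points. Writing \<open>L\<close> for the number of leaves and
  subtracting the contributions of \<open>a\<close> and \<open>b\<close> gives \<open>4 L = q - 3 + \<chi>(a - b) + \<chi>(b - a)\<close>
  (\<open>num_leaves_quadratic_pair\<close>).

  The formula of the theorem is then a matter of divisibility by \<open>4\<close>. The two characters are
  \<open>1\<close> or \<open>-1\<close>, so for \<open>q = 4k + 3\<close> they must cancel and for \<open>q = 4k + 1\<close> they must
  agree; the value of \<open>\<chi>(-1)\<close> comes out of the count instead of going into it.
\<close>

section \<open>Square roots in a finite field of odd order\<close>

text \<open>
  Translation by \<open>1\<close> permutes the field, so the sum of all elements is unchanged when the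
  order of the field is added to it. The order is thus \<open>0\<close> in the field, whereas an odd number is
  \<open>1\<close> in characteristic two.
\<close>

lemma two_neq_zero_if_odd_card:
  assumes "odd (card (UNIV :: 'a::{field,finite} set))"
  shows "(2 :: 'a) \<noteq> 0"
proof
  assume two: "(2 :: 'a) = 0"
  have "(\<Sum>x\<in>UNIV. x + 1) = (\<Sum>x\<in>UNIV. x :: 'a)"
    by (rule sum.reindex_bij_witness[of _ "\<lambda>x. x - 1" "\<lambda>x. x + 1"]) auto
  hence "of_nat (card (UNIV :: 'a set)) = (0 :: 'a)"
    by (simp add: sum.distrib)
  moreover obtain n where "card (UNIV :: 'a set) = 2 * n + 1"
    using assms by (elim oddE)
  ultimately show False
    using two by simp
qed

lemma card_square_roots:
  fixes u :: "'a::{field,finite}"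
  assumes "(2 :: 'a) \<noteq> 0"
  shows "int (card {x. x\<^sup>2 = u}) = 1 + quadratic_character u"
proof (cases "\<exists>w. u = w\<^sup>2")
  case True
  then obtain w where w: "u = w\<^sup>2" by blast
  have roots: "{x. x\<^sup>2 = u} = {w, - w}"
    unfolding w by (auto simp: power2_eq_iff)
  show ?thesis
  proof (cases "w = 0")
    case True
    thus ?thesis using roots w by (simp add: quadratic_character_def)
  next
    case False
    have "w \<noteq> - w"
    proof
      assume "w = - w"
      hence "2 * w = 0" by (metis add.right_inverse mult_2)
      thus False using assms False by simp
    qed
    thus ?thesis using roots w False by (auto simp: quadratic_character_def)
  qed
next
  case False
  hence "{x. x\<^sup>2 = u} = {}" "u \<noteq> 0" by auto
  thus ?thesis using False by (simp add: quadratic_character_def)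
qed

section \<open>Sums of the quadratic character\<close>

lemma sum_quadratic_character:
  assumes "(2 :: 'a::{field,finite}) \<noteq> 0"
  shows "(\<Sum>u\<in>UNIV. quadratic_character (u :: 'a)) = 0"
proof -
  have "(\<Sum>u\<in>UNIV. card {x :: 'a. x\<^sup>2 = u}) = card (\<Union>u. {x :: 'a. x\<^sup>2 = u})"
    by (rule card_UN_disjoint[symmetric]) auto
  also have "(\<Union>u. {x :: 'a. x\<^sup>2 = u}) = UNIV" by auto
  finally have "(\<Sum>u\<in>UNIV. int (card {x :: 'a. x\<^sup>2 = u})) = int (card (UNIV :: 'a set))"
    by (simp flip: of_nat_sum)
  thus ?thesis
    by (simp add: card_square_roots[OF assms] sum.distrib)
qed

lemma sum_quadratic_character_shift:
  assumes "(2 :: 'a::{field,finite}) \<noteq> 0"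
  shows "(\<Sum>v\<in>UNIV. quadratic_character (v - c :: 'a)) = 0"
proof -
  have "(\<Sum>v\<in>UNIV. quadratic_character (v - c)) = (\<Sum>u\<in>UNIV. quadratic_character (u :: 'a))"
    by (rule sum.reindex_bij_witness[of _ "\<lambda>u. u + c" "\<lambda>v. v - c"]) auto
  thus ?thesis using sum_quadratic_character[OF assms] by simp
qed

text \<open>
  In the coordinates \<open>s = x - y\<close>, \<open>t = x + y\<close> the curve is \<open>s t = b - a\<close>, which has one point for
  each \<open>s \<noteq> 0\<close>.
\<close>

lemma card_hyperbola:
  fixes a b :: "'a::{field,finite}"
  assumes two: "(2 :: 'a) \<noteq> 0" and "a \<noteq> b"
  shows "card {(x, y). x\<^sup>2 + a = y\<^sup>2 + b} = card (UNIV :: 'a set) - 1"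
proof -
  let ?H = "{(x, y). x\<^sup>2 + a = y\<^sup>2 + b}"
  define d where "d = b - a"
  have d: "d \<noteq> 0" using assms by (simp add: d_def)
  have H_iff: "x\<^sup>2 + a = y\<^sup>2 + b \<longleftrightarrow> (x - y) * (x + y) = d" for x y
  proof -
    have "x\<^sup>2 + a = y\<^sup>2 + b \<longleftrightarrow> x\<^sup>2 - y\<^sup>2 = d"
      unfolding d_def by (auto simp: algebra_simps)
    also have "x\<^sup>2 - y\<^sup>2 = (x - y) * (x + y)"
      by (simp add: power2_eq_square algebra_simps)
    finally show ?thesis .
  qed
  have diff: "(s + d / s) / 2 - (d / s - s) / 2 = s" for s
    using two by (simp add: diff_divide_distrib[symmetric])
  have sum: "(s + d / s) / 2 + (d / s - s) / 2 = d / s" for s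
    using two by (simp add: add_divide_distrib[symmetric])
  have inv: "((x - y) + d / (x - y)) / 2 = x \<and> (d / (x - y) - (x - y)) / 2 = y"
    if "(x - y) * (x + y) = d" for x y
  proof -
    have "d / (x - y) = x + y" using that d by (metis mult_zero_left nonzero_mult_div_cancel_left)
    thus ?thesis using two by simp
  qed
  let ?point = "\<lambda>s. ((s + d / s) / 2, (d / s - s) / 2)"
  let ?diff = "\<lambda>(x, y). x - y :: 'a"
  have "bij_betw ?point (UNIV - {0}) ?H"
  proof (rule bij_betw_byWitness[where f' = ?diff])
    show "\<forall>s\<in>UNIV - {0}. ?diff (?point s) = s"
      unfolding prod.case diff by simp
    show "\<forall>p\<in>?H. ?point (?diff p) = p"
      unfolding H_iff by (simp add: inv split_paired_all)
    show "?point ` (UNIV - {0}) \<subseteq> ?H"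
    proof (rule image_subsetI)
      fix s :: 'a
      assume "s \<in> UNIV - {0}"
      thus "?point s \<in> ?H"
        unfolding H_iff mem_Collect_eq prod.case diff sum by simp
    qed
    show "?diff ` ?H \<subseteq> UNIV - {0}"
      unfolding H_iff using d by auto
  qed
  hence "card (UNIV - {0 :: 'a}) = card ?H" by (rule bij_betw_same_card)
  thus ?thesis by simp
qed

text \<open>
  The product \<open>(1 + \<chi>(v - a)) (1 + \<chi>(v - b))\<close> counts the points \<open>(x, y)\<close> of the hyperbola whose
  common value \<open>x\<^sup>2 + a = y\<^sup>2 + b\<close> is \<open>v\<close>, so its sum over \<open>v\<close> is \<open>q - 1\<close>; in the expansion all
  terms but \<open>q\<close> and the sum below vanish.
\<close>

lemma sum_quadratic_character_correlation:
  fixes a b :: "'a::{field,finite}"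
  assumes two: "(2 :: 'a) \<noteq> 0" and "a \<noteq> b"
  shows "(\<Sum>v\<in>UNIV. quadratic_character (v - a) * quadratic_character (v - b)) = -1"
proof -
  let ?R = "\<lambda>c v. {x :: 'a. x\<^sup>2 = v - c}"
  have "card (\<Union>v. ?R a v \<times> ?R b v) = (\<Sum>v\<in>UNIV. card (?R a v \<times> ?R b v))"
    by (rule card_UN_disjoint) auto
  also have "(\<Union>v. ?R a v \<times> ?R b v) = {(x, y). x\<^sup>2 + a = y\<^sup>2 + b}"
    by (auto simp: algebra_simps)
  finally have "(\<Sum>v\<in>UNIV. card (?R a v) * card (?R b v)) = card (UNIV :: 'a set) - 1"
    by (simp add: card_hyperbola[OF assms] card_cartesian_product)
  hence "(\<Sum>v\<in>UNIV. int (card (?R a v)) * int (card (?R b v))) = int (card (UNIV :: 'a set) - 1)"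
    by (simp flip: of_nat_mult of_nat_sum)
  also have "\<dots> = int (card (UNIV :: 'a set)) - 1"
    by (simp add: of_nat_diff Suc_leI card_gt_0_iff)
  finally show ?thesis
    by (simp add: card_square_roots[OF two] distrib_left distrib_right sum.distrib
        sum_quadratic_character_shift[OF two])
qed

section \<open>Leaves as pairs of non-squares\<close>

lemma leaves_quadratic_pair:
  fixes a b :: "'a::{field,finite}"
  shows "leaves (poly_graph (map (\<lambda>a. [:a, 0, 1:]) [a, b])) =
    {v. quadratic_character (v - a) = -1 \<and> quadratic_character (v - b) = -1}"
proof -
  let ?G = "poly_graph (map (\<lambda>a. [:a, 0, 1:]) [a, b])"
  have nonsquare: "quadratic_character (v - c) = -1 \<longleftrightarrow> (\<nexists>u. c + u * u = v)" for v c :: 'a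
  proof -
    have "c + u * u = v \<longleftrightarrow> v - c = u\<^sup>2" for u
      by (auto simp: power2_eq_square algebra_simps)
    thus ?thesis
      by (auto simp: quadratic_character_def)
  qed
  have "in_degree (with_proj ?G) v = 0 \<longleftrightarrow> (\<nexists>u. a + u * u = v) \<and> (\<nexists>u. b + u * u = v)" for v
  proof -
    have "in_arcs (with_proj ?G) v = {(u, w). w = v \<and> (a + u * u = w \<or> b + u * u = w)}"
      by (auto simp: in_arcs_def poly_graph_def with_proj_def)
    thus ?thesis by (auto simp: in_degree_def card_eq_0_iff)
  qed
  thus ?thesis by (simp add: leaves_def nonsquare) (simp add: poly_graph_def)
qed

text \<open>
  The products below sum to \<open>q - 1\<close>. Away from the leaves they survive only at \<open>a\<close> and at \<open>b\<close>,
  where they equal \<open>1 - \<chi>(a - b)\<close> and \<open>1 - \<chi>(b - a)\<close>.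
\<close>

lemma num_leaves_quadratic_pair:
  fixes a b :: "'a::{field,finite}"
  assumes two: "(2 :: 'a) \<noteq> 0" and "a \<noteq> b"
  shows "4 * int (num_leaves [a, b]) =
    int (card (UNIV :: 'a set)) - 3 + quadratic_character (a - b) + quadratic_character (b - a)"
proof -
  let ?\<chi> = "quadratic_character :: 'a \<Rightarrow> int"
  let ?L = "{v. ?\<chi> (v - a) = -1 \<and> ?\<chi> (v - b) = -1}"
  have \<chi>0: "?\<chi> u = 0 \<longleftrightarrow> u = 0" and \<chi>: "?\<chi> u \<in> {0, 1, -1}" for u
    by (auto simp: quadratic_character_def)
  have pointwise: "(1 - ?\<chi> (v - a)) * (1 - ?\<chi> (v - b)) =
      (if v \<in> ?L then 4 else 0) + (if v = a then 1 - ?\<chi> (a - b) else 0)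
      + (if v = b then 1 - ?\<chi> (b - a) else 0)" for v
    using \<chi>[of "v - a"] \<chi>[of "v - b"] \<chi>0[of "v - a"] \<chi>0[of "v - b"] \<open>a \<noteq> b\<close> by auto
  have "(\<Sum>v\<in>UNIV. (1 - ?\<chi> (v - a)) * (1 - ?\<chi> (v - b))) = int (card (UNIV :: 'a set)) - 1"
    by (simp add: left_diff_distrib right_diff_distrib sum_subtractf sum.distrib
        sum_quadratic_character_shift[OF two] sum_quadratic_character_correlation[OF assms])
  moreover have "(\<Sum>v\<in>UNIV. (1 - ?\<chi> (v - a)) * (1 - ?\<chi> (v - b))) =
      4 * int (card ?L) + (1 - ?\<chi> (a - b)) + (1 - ?\<chi> (b - a))"
    unfolding pointwise by (simp add: sum.distrib sum.If_cases)
  ultimately show ?thesis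
    unfolding num_leaves_def leaves_quadratic_pair by simp
qed

theorem theorem2p4:
  fixes a b :: "'a::{field,finite}" and p m q :: nat and k :: int
  assumes "prime p" and "odd p" and "m > 0" and "q = p ^ m"
    and "card (UNIV :: 'a set) = q"
    and "int q = 4 * k + 1 \<or> int q = 4 * k + 3"
    and "a \<noteq> b"
  shows "real (num_leaves [a, b]) =
    real_of_int k +
      (if q mod 4 = 1 then (real_of_int (quadratic_character (a - b)) - 1) / 2 else 0)"
proof -
  have "(2 :: 'a) \<noteq> 0"
    using assms by (intro two_neq_zero_if_odd_card) simp
  from num_leaves_quadratic_pair[OF this \<open>a \<noteq> b\<close>]
  have count: "4 * int (num_leaves [a, b]) =
      int q - 3 + quadratic_character (a - b) + quadratic_character (b - a)"
    using assms by simp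
  have sign: "quadratic_character u = 1 \<or> quadratic_character u = -1" if "u \<noteq> 0" for u :: 'a
    using that by (auto simp: quadratic_character_def)
  have signs: "quadratic_character (a - b) = 1 \<or> quadratic_character (a - b) = -1"
    "quadratic_character (b - a) = 1 \<or> quadratic_character (b - a) = -1"
    using \<open>a \<noteq> b\<close> by (auto intro!: sign)
  from assms(6) show ?thesis
  proof
    assume q: "int q = 4 * k + 1"
    hence "q mod 4 = 1" by presburger
    moreover have "2 * int (num_leaves [a, b]) = 2 * k + quadratic_character (a - b) - 1"
      using signs count q by (elim disjE; simp; presburger?)
    hence "2 * real (num_leaves [a, b]) = 2 * real_of_int k + real_of_int (quadratic_character (a - b)) - 1"
      by linarith
    ultimately show ?thesis by (simp add: field_simps)
  next
    assume q: "int q = 4 * k + 3"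
    hence "q mod 4 \<noteq> 1" by presburger
    moreover have "int (num_leaves [a, b]) = k"
      using signs count q by (elim disjE; simp; presburger?)
    hence "real (num_leaves [a, b]) = real_of_int k" by linarith
    ultimately show ?thesis by simp
  qed
qed

end
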